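(* Let $n = 2^r$ for some positive integer $r$ and let $m$ be a positive integer with $m \leq n/2 = 2^{r-1}$. Let $Y_r = [\mathbf{y}_1,\ldots,\mathbf{y}_n] \in \mathbb{C}^{n\times n}$ be the Walsh matrix of order $r$ with columns $\mathbf{y}_j$, let $W = \frac{1}{\sqrt{n}}[\mathbf{y}_1,\ldots,\mathbf{y}_m] \in \mathbb{C}^{n\times m}$ be the matrix formed from its first $m$ columns divided by $\sqrt{n}$, and let $V = [\mathbf{v}_1,\ldots,\mathbf{v}_n] = W^* \in \mathbb{C}^{m\times n}$. Then $VV^* = I_m$ (so the columns of $V$ form a Parseval frame for $\mathbb{C}^m$), and this frame can be split into two identical tight frames for $\mathbb{C}^m$ given by the columns of $V_1 = [\mathbf{v}_1,\ldots,\mathbf{v}_{n/2}]$ and $V_2 = [\mathbf{v}_{n/2+1},\ldots,\mathbf{v}_n]$: that is, $V_1 = V_2$ and $$V_1V_1^* = V_2V_2^* = \tfrac12 I_m.$$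
   Context: The Walsh matrices (natural ordering, Sylvester construction) are defined recursively by $Y_0 = [1]$ and $Y_r = \begin{bmatrix} Y_{r-1} & Y_{r-1} \\ Y_{r-1} & -Y_{r-1}\end{bmatrix}$ for $r \geq 1$, so $Y_r$ is a $2^r \times 2^r$ matrix with entries $\pm 1$. A finite family $\mathbf{v}_1,\ldots,\mathbf{v}_n \in \mathbb{C}^m$ is a tight frame for $\mathbb{C}^m$ with frame constant $c>0$ if $\sum_{j=1}^n |\mathbf{v}_j^*\mathbf{x}|^2 = c$ for all $\mathbf{x}\in\mathbb{C}^m$ with $\|\mathbf{x}\|=1$; equivalently $VV^* = cI_m$ where $V=[\mathbf{v}_1,\ldots,\mathbf{v}_n]$. It is a Parseval frame if $c=1$. Here $^*$ denotes conjugate transpose and $I_m$ the $m\times m$ identity matrix. *)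

theory Defs
  imports Complex_Main "Jordan_Normal_Form.Schur_Decomposition"
begin

primrec walsh :: "nat \<Rightarrow> complex mat" where
  "walsh 0 = mat_of_rows_list 1 [[1]]"
| "walsh (Suc r) = four_block_mat (walsh r) (walsh r) (walsh r) (- walsh r)"

definition euclid_norm :: "complex vec \<Rightarrow> real" where
  "euclid_norm x = sqrt (\<Sum>i<dim_vec x. (cmod (x $ i))\<^sup>2)"

text \<open>A finite family is a list, so repeated vectors count with multiplicity.
  The scalar product \<open>x \<bullet>c v\<close> conjugates its second argument, i.e. it is
  the number written \<open>v\<^sup>* x\<close> in matrix notation.\<close>

definition tight_frame :: "nat \<Rightarrow> real \<Rightarrow> complex vec list \<Rightarrow> bool" where
  "tight_frame m c vs \<longleftrightarrow> 0 < c \<and> set vs \<subseteq> carrier_vec m \<and>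
     (\<forall>x \<in> carrier_vec m. euclid_norm x = 1 \<longrightarrow>
        (\<Sum>j<length vs. (cmod (x \<bullet>c (vs ! j)))\<^sup>2) = c)"

definition parseval_frame :: "nat \<Rightarrow> complex vec list \<Rightarrow> bool" where
  "parseval_frame m vs \<longleftrightarrow> tight_frame m 1 vs"

end

theory Submission
  imports Defs
begin

text \<open>
  The columns of a Walsh matrix are orthogonal: in \<open>Y\<^sub>r\<close>, for \<open>r > 0\<close>, the inner product of
  columns \<open>a\<close> and \<open>b\<close> is the sum of a contribution of the upper and one of the lower half of the
  rows. Each contribution is, up to sign, the inner product of columns \<open>a mod 2\<^bsup>r-1\<^esup>\<close> and
  \<open>b mod 2\<^bsup>r-1\<^esup>\<close> of \<open>Y\<^bsub>r-1\<^esub>\<close>. The two are equal when both columns lie in the same half of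
  the columns of \<open>Y\<^sub>r\<close>, because the sign of the block \<open>-Y\<^bsub>r-1\<^esub>\<close> occurs squared or not at
  all; otherwise that sign occurs once and they cancel. Hence \<open>Y\<^sub>r\<^sup>T Y\<^sub>r = 2\<^sup>r I\<close> by
  induction (\<open>walsh_column_orthogonality\<close>).

  The frame splits because the first half of the columns of \<open>Y\<^sub>r\<close> never meets the block
  \<open>-Y\<^bsub>r-1\<^esub>\<close>: these columns consist of two stacked copies of the columns of \<open>Y\<^bsub>r-1\<^esub>\<close>. Since
  \<open>m \<le> n/2\<close>, only such columns are used, so \<open>V\<close> is two copies of one \<open>m \<times> n/2\<close>
  matrix side by side. Orthogonality in order \<open>r - 1\<close> gives \<open>(1/n) (n/2) = 1/2\<close> for each half,
  and orthogonality in order \<open>r\<close> gives \<open>1\<close> for all of \<open>V\<close>. The step from these matrix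
  identities to frames is \<open>tight_frame_cols\<close>.
\<close>

section \<open>Tight frames from Gram identities\<close>

lemma index_mult_mat_adjoint:
  fixes A :: "complex mat"
  assumes "A \<in> carrier_mat m N" "a < m" "b < m"
  shows "(A * mat_adjoint A) $$ (a, b) = (\<Sum>k<N. A $$ (a, k) * cnj (A $$ (b, k)))"
  using assms
  by (auto simp: mat_adjoint_def scalar_prod_def mat_of_rows_def atLeast0LessThan intro!: sum.cong)

lemma dim_mat_adjoint: "dim_row (mat_adjoint A) = dim_col A" "dim_col (mat_adjoint A) = dim_row A"
  by (simp_all add: mat_adjoint_def)

lemma mult_mat_adjoint_eq_smult_one:
  fixes A :: "complex mat"
  assumes "A \<in> carrier_mat m N"
    and "\<And>a b. a < m \<Longrightarrow> b < m \<Longrightarrow>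
      (\<Sum>k<N. A $$ (a, k) * cnj (A $$ (b, k))) = (if a = b then c else 0)"
  shows "A * mat_adjoint A = c \<cdot>\<^sub>m 1\<^sub>m m"
  using assms
  by (intro eq_matI) (auto simp: index_mult_mat_adjoint dim_mat_adjoint simp del: index_mult_mat(1))

text \<open>The matrix identity \<open>A A\<^sup>* = c I\<close> is the polarised form of the frame condition: expanding
  the squared moduli and exchanging sums, \<open>\<Sum>\<^sub>j |a\<^sub>j\<^sup>* x|\<^sup>2 = x\<^sup>* (A A\<^sup>*) x = c \<parallel>x\<parallel>\<^sup>2\<close>.\<close>

lemma tight_frame_cols:
  fixes A :: "complex mat"
  assumes A: "A \<in> carrier_mat m N" and c: "0 < c"
    and gram: "A * mat_adjoint A = complex_of_real c \<cdot>\<^sub>m 1\<^sub>m m"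
  shows "tight_frame m c (cols A)"
  unfolding tight_frame_def
proof (intro conjI ballI impI)
  show "0 < c" by (fact c)
  show "set (cols A) \<subseteq> carrier_vec m"
    using A cols_dim by blast
  fix x :: "complex vec"
  assume x: "x \<in> carrier_vec m" and "euclid_norm x = 1"
  then have norm: "(\<Sum>i<m. (cmod (x $ i))\<^sup>2) = 1"
    by (simp add: euclid_norm_def)
  have rows: "(\<Sum>j<N. A $$ (k, j) * cnj (A $$ (i, j))) = (if k = i then complex_of_real c else 0)"
    if "k < m" "i < m" for k i
    using index_mult_mat_adjoint[OF A that] that by (simp add: gram split: if_splits)
  have inner: "x \<bullet>c (cols A ! j) = (\<Sum>i<m. x $ i * cnj (A $$ (i, j)))" if "j < N" for j
    using that A x by (auto simp: scalar_prod_def atLeast0LessThan intro!: sum.cong)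
  have "complex_of_real (\<Sum>j<N. (cmod (x \<bullet>c (cols A ! j)))\<^sup>2)
      = (\<Sum>j<N. \<Sum>i<m. \<Sum>k<m. (x $ i * cnj (x $ k)) * (A $$ (k, j) * cnj (A $$ (i, j))))"
    by (simp add: inner complex_norm_square sum_product mult_ac del: of_real_power)
  also have "\<dots> = (\<Sum>i<m. \<Sum>k<m. (x $ i * cnj (x $ k)) * (\<Sum>j<N. A $$ (k, j) * cnj (A $$ (i, j))))"
    by (subst sum.swap, rule sum.cong[OF refl], subst sum.swap) (simp add: sum_distrib_left)
  also have "\<dots> = (\<Sum>i<m. \<Sum>k<m. if k = i then (x $ i * cnj (x $ i)) * complex_of_real c else 0)"
    by (intro sum.cong refl) (simp add: rows)
  also have "\<dots> = complex_of_real ((\<Sum>i<m. (cmod (x $ i))\<^sup>2) * c)"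
    by (simp add: complex_norm_square sum_distrib_right del: of_real_power)
  finally have "(\<Sum>j<N. (cmod (x \<bullet>c (cols A ! j)))\<^sup>2) = c"
    unfolding norm of_real_eq_iff by simp
  then show "(\<Sum>j<length (cols A). (cmod (x \<bullet>c (cols A ! j)))\<^sup>2) = c"
    using A by simp
qed

section \<open>Walsh matrices\<close>

lemma walsh_carrier: "walsh r \<in> carrier_mat (2 ^ r) (2 ^ r)"
proof (induction r)
  case 0
  show ?case by (simp add: mat_of_rows_list_def)
next
  case (Suc r)
  then have "walsh (Suc r) \<in> carrier_mat (2 ^ r + 2 ^ r) (2 ^ r + 2 ^ r)"
    unfolding walsh.simps by (intro four_block_carrier_mat) auto
  then show ?case by (simp add: mult_2)
qed

lemma dim_walsh [simp]: "dim_row (walsh r) = 2 ^ r" "dim_col (walsh r) = 2 ^ r"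
  using walsh_carrier[of r] by auto

lemma walsh_blocks:
  assumes "i < 2 ^ r" "j < 2 ^ r"
  shows "walsh (Suc r) $$ (i, j) = walsh r $$ (i, j)"
    and "walsh (Suc r) $$ (i, 2 ^ r + j) = walsh r $$ (i, j)"
    and "walsh (Suc r) $$ (2 ^ r + i, j) = walsh r $$ (i, j)"
    and "walsh (Suc r) $$ (2 ^ r + i, 2 ^ r + j) = - walsh r $$ (i, j)"
  using assms by auto

lemma index_half_cases:
  fixes i r :: nat
  assumes "i < 2 ^ Suc r"
  obtains "i < 2 ^ r" | i' :: nat where "i = 2 ^ r + i'" "i' < 2 ^ r"
proof (cases "i < 2 ^ r")
  case False
  with assms have "i = 2 ^ r + (i - 2 ^ r)" "i - 2 ^ r < 2 ^ r" by auto
  with that(2) show ?thesis by blast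
qed (use that in blast)

text \<open>This turns inner products of columns over the complex numbers into the plain sums of
  products to which the recursion applies.\<close>

lemma cnj_walsh:
  assumes "i < 2 ^ r" "j < 2 ^ r"
  shows "cnj (walsh r $$ (i, j)) = walsh r $$ (i, j)"
  using assms
proof (induction r arbitrary: i j)
  case 0
  then show ?case by (simp add: mat_of_rows_list_def)
next
  case (Suc r)
  show ?case
    by (rule index_half_cases[OF Suc.prems(1)]; rule index_half_cases[OF Suc.prems(2)])
      (simp_all add: walsh_blocks Suc.IH del: walsh.simps)
qed

lemma sum_lessThan_add:
  fixes f :: "nat \<Rightarrow> 'a::comm_monoid_add"
  shows "(\<Sum>k<a + b. f k) = (\<Sum>k<a. f k) + (\<Sum>k<b. f (a + k))"
  by (induction b) (simp_all add: add.assoc)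

lemma sum_two_halves:
  fixes f :: "nat \<Rightarrow> 'a::comm_monoid_add"
  shows "(\<Sum>k<2 ^ Suc r. f k) = (\<Sum>k<2 ^ r. f k) + (\<Sum>k<2 ^ r. f (2 ^ r + k))"
  using sum_lessThan_add[of f "2 ^ r" "2 ^ r"] by (simp add: mult_2)

text \<open>If both columns lie in the same half, the two half-sums over the rows are equal and the
  induction hypothesis gives their common value; otherwise the lower right block makes them
  cancel.\<close>

lemma walsh_column_orthogonality:
  assumes "a < 2 ^ r" "b < 2 ^ r"
  shows "(\<Sum>k<2 ^ r. walsh r $$ (k, a) * walsh r $$ (k, b)) = (if a = b then 2 ^ r else 0)"
  using assms
proof (induction r arbitrary: a b)
  case 0
  then show ?case by (simp add: mat_of_rows_list_def)
next
  case (Suc r)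
  show ?case
    unfolding sum_two_halves
    by (rule index_half_cases[OF Suc.prems(1)]; rule index_half_cases[OF Suc.prems(2)])
      (simp_all add: walsh_blocks Suc.IH sum_negf del: walsh.simps)
qed

section \<open>Splitting the Walsh frame\<close>

theorem theorem2p2:
  fixes r n m :: nat and W V V1 V2 :: "complex mat"
  assumes "r > 0"
    and "n = 2 ^ r"
    and "m > 0"
    and "m \<le> n div 2"
    and "W = complex_of_real (1 / sqrt (real n)) \<cdot>\<^sub>m mat_of_cols n (take m (cols (walsh r)))"
    and "V = mat_adjoint W"
    and "V1 = mat_of_cols m (take (n div 2) (cols V))"
    and "V2 = mat_of_cols m (drop (n div 2) (cols V))"
  shows "walsh r \<in> carrier_mat n n \<and> W \<in> carrier_mat n m \<and> V \<in> carrier_mat m n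
    \<and> V * mat_adjoint V = 1\<^sub>m m
    \<and> parseval_frame m (cols V)
    \<and> V1 = V2
    \<and> V1 * mat_adjoint V1 = (1 / 2) \<cdot>\<^sub>m 1\<^sub>m m
    \<and> V2 * mat_adjoint V2 = (1 / 2) \<cdot>\<^sub>m 1\<^sub>m m
    \<and> tight_frame m (1 / 2) (cols V1)
    \<and> tight_frame m (1 / 2) (cols V2)"
proof -
  define s where "s = complex_of_real (1 / sqrt (real n))"
  obtain p where r: "r = Suc p"
    using \<open>r > 0\<close> gr0_implies_Suc by blast
  define h :: nat where "h = 2 ^ p"
  have n: "n = 2 * h" "n div 2 = h" "n = 2 ^ Suc p" and h: "0 < h" and m: "m \<le> h"
    using assms(2,4) by (auto simp: r h_def)
  have "s * s = complex_of_real (1 / sqrt (real n) * (1 / sqrt (real n)))"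
    by (simp only: s_def of_real_mult)
  also have "\<dots> = 1 / of_nat n"
    by (simp del: of_real_mult)
  finally have s: "cnj s = s" "s * s = 1 / of_nat n"
    by (simp_all add: s_def)
  have walsh_dim: "walsh r \<in> carrier_mat n n"
    using walsh_carrier[of r] assms(2) by simp
  have W: "W \<in> carrier_mat n m"
    using m n by (intro carrier_matI) (auto simp: assms(5) r)
  have V: "V \<in> carrier_mat m n"
    using W by (auto simp: assms(6) mat_adjoint_def)
  have V_entry: "V $$ (i, k) = s * walsh r $$ (k, i)" if "i < m" "k < n" for i k
  proof -
    have "W $$ (k, i) = s * walsh r $$ (k, i)"
      using that walsh_dim m n by (auto simp: assms(5) s_def mat_of_cols_index)
    moreover have "V $$ (i, k) = cnj (W $$ (k, i))"
      using that W by (auto simp: assms(6) mat_adjoint_def mat_of_rows_def)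
    moreover have "cnj (walsh r $$ (k, i)) = walsh r $$ (k, i)"
      using that m n by (intro cnj_walsh) (auto simp: r)
    ultimately show ?thesis by (simp add: s)
  qed
  have V1: "V1 \<in> carrier_mat m h" and V2: "V2 \<in> carrier_mat m h"
    using V n by (auto simp: assms(7,8))
  \<comment> \<open>As \<open>m \<le> h\<close>, only the two left blocks of \<open>walsh r\<close> are read here, and both are
    \<open>walsh p\<close>.\<close>
  have V1_entry: "V1 $$ (i, k) = s * walsh p $$ (k, i)" if "i < m" "k < h" for i k
    using that V n m by (auto simp: assms(7) mat_of_cols_index V_entry r h_def walsh_blocks
        simp del: walsh.simps)
  have V2_entry: "V2 $$ (i, k) = s * walsh p $$ (k, i)" if "i < m" "k < h" for i k
    using that V n m by (auto simp: assms(8) mat_of_cols_index V_entry r h_def walsh_blocks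
        simp del: walsh.simps)
  have V1_eq_V2: "V1 = V2"
    using V1 V2 by (intro eq_matI) (auto simp: V1_entry V2_entry)
  \<comment> \<open>All three Gram identities are this one: \<open>V\<close> is the case \<open>q = r\<close>, and the halves
    \<open>V1 = V2\<close> are the case \<open>q = p\<close>, with the scaling \<open>s\<close> of order \<open>r\<close>.\<close>
  have gram: "A * mat_adjoint A = (2 ^ q / of_nat n) \<cdot>\<^sub>m 1\<^sub>m m"
    if A: "A \<in> carrier_mat m (2 ^ q)" and q: "m \<le> 2 ^ q"
      and entry: "\<And>i k. i < m \<Longrightarrow> k < 2 ^ q \<Longrightarrow> A $$ (i, k) = s * walsh q $$ (k, i)"
    for A q
  proof (rule mult_mat_adjoint_eq_smult_one[OF A])
    fix a b assume ab: "a < m" "b < m"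
    then have lt: "a < 2 ^ q" "b < 2 ^ q" using q by auto
    have "(\<Sum>k<2 ^ q. A $$ (a, k) * cnj (A $$ (b, k)))
        = (\<Sum>k<2 ^ q. (s * s) * (walsh q $$ (k, a) * walsh q $$ (k, b)))"
      using ab lt by (intro sum.cong refl) (simp add: entry cnj_walsh s(1) mult_ac)
    also have "\<dots> = (s * s) * (if a = b then 2 ^ q else 0)"
      unfolding sum_distrib_left[symmetric] walsh_column_orthogonality[OF lt] ..
    finally show "(\<Sum>k<2 ^ q. A $$ (a, k) * cnj (A $$ (b, k)))
        = (if a = b then 2 ^ q / of_nat n else 0)"
      by (simp add: s(2))
  qed
  have one_smult: "(1 :: complex) \<cdot>\<^sub>m 1\<^sub>m m = 1\<^sub>m m"
    by (intro eq_matI) auto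
  have VV: "V * mat_adjoint V = 1\<^sub>m m"
  proof -
    have "V * mat_adjoint V = (2 ^ r / of_nat n) \<cdot>\<^sub>m 1\<^sub>m m"
      using V V_entry m n h by (intro gram) (auto simp: r)
    also have "2 ^ r / of_nat n = (1 :: complex)"
      by (simp add: assms(2))
    finally show ?thesis by (simp only: one_smult)
  qed
  have half: "V1 * mat_adjoint V1 = (1 / 2) \<cdot>\<^sub>m 1\<^sub>m m"
  proof -
    have "V1 * mat_adjoint V1 = (2 ^ p / of_nat n) \<cdot>\<^sub>m 1\<^sub>m m"
      using V1 V1_entry m by (intro gram) (auto simp: h_def)
    also have "2 ^ p / of_nat n = (1 / 2 :: complex)"
      by (simp add: n(3))
    finally show ?thesis .
  qed
  have "parseval_frame m (cols V)"
    unfolding parseval_frame_def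
    using VV by (intro tight_frame_cols[OF V]) (simp_all add: one_smult)
  moreover have "tight_frame m (1 / 2) (cols V1)"
    using half by (intro tight_frame_cols[OF V1]) simp_all
  ultimately show ?thesis
    using walsh_dim W V VV half V1_eq_V2 by simp
qed

end
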